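(* Let $G$ be a groupoid and $x$ an object in $G$. Then: (1) $\pi_0(G/x)$ is a discrete poset (i.e. $a\le b$ implies $a=b$); and (2) as a pointed set, $\pi_0(G/x)$ is isomorphic to the set $\pi_0(G)$ of connected components of $G$, pointed with the connected component of $x$.
   Context: Poset reflection: for a category $C$, $\|C\|$ is the poset whose elements are equivalence classes $\|x\|$ of objects $x$ of $C$, with $\|x\|=\|y\|$ iff there exist morphisms $x\to y$ and $y\to x$, and $\|x\|\le\|y\|$ iff there exists a morphism $x\to y$ in $C$. This is functorial in $C$. Zeroth homotopy poset: for an object $x$ of a category $C$, the functor $\mathrm{dom}\colon C/x\to C$ from the slice category induces an order-preserving map $\|\mathrm{dom}\|\colon \|C/x\|\to\|C\|$. The pointed poset $(\pi_0(C/x),[x])$ is the quotient of $\|C\|$ by this map, i.e. the pushout in the category of posets of $\|\mathrm{dom}\|$ along the unique map $\|C/x\|\to 1$ to the one-element poset, pointed with the image $[x]$ of the element of $1$. Explicitly, an element of $\pi_0(C/x)$ is either $[x]$, or $\|y\|$ for an object $y$ such that there is no morphism $y\to x$; the order is: $[x]\le[x]$; $[x]\le\|y\|$ iff there is a span $x\leftarrow z\to y$ in $C$; never $\|y\|\le[x]$; and $\|y\|\le\|z\|$ iff there is a morphism $y\to z$. *)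

theory Defs
  imports Main
begin

section \<open>Categories, groupoids, functors\<close>

record ('o, 'm) cat =
  Obj :: "'o set"
  Arr :: "'m set"
  Dom :: "'m \<Rightarrow> 'o"
  Cod :: "'m \<Rightarrow> 'o"
  Id :: "'o \<Rightarrow> 'm"
  Comp :: "'m \<Rightarrow> 'm \<Rightarrow> 'm"

text \<open>Composition is written in the usual order: \<open>Comp C g f\<close> is \<open>f\<close> followed by \<open>g\<close>.\<close>

definition hom :: "('o, 'm) cat \<Rightarrow> 'o \<Rightarrow> 'o \<Rightarrow> 'm set" where
  "hom C x y = {f \<in> Arr C. Dom C f = x \<and> Cod C f = y}"

locale category =
  fixes C :: "('o, 'm) cat"
  assumes dom_obj: "f \<in> Arr C \<Longrightarrow> Dom C f \<in> Obj C"
    and cod_obj: "f \<in> Arr C \<Longrightarrow> Cod C f \<in> Obj C"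
    and id_hom: "x \<in> Obj C \<Longrightarrow> Id C x \<in> hom C x x"
    and comp_hom: "\<lbrakk>f \<in> hom C x y; g \<in> hom C y z\<rbrakk> \<Longrightarrow> Comp C g f \<in> hom C x z"
    and comp_id_right: "f \<in> hom C x y \<Longrightarrow> Comp C f (Id C x) = f"
    and comp_id_left: "f \<in> hom C x y \<Longrightarrow> Comp C (Id C y) f = f"
    and comp_assoc: "\<lbrakk>f \<in> hom C w x; g \<in> hom C x y; h \<in> hom C y z\<rbrakk>
      \<Longrightarrow> Comp C h (Comp C g f) = Comp C (Comp C h g) f"

locale groupoid = category G for G :: "('o, 'm) cat" +
  assumes inverse_ex: "f \<in> hom G x y \<Longrightarrow>
    \<exists>g \<in> hom G y x. Comp G g f = Id G x \<and> Comp G f g = Id G y"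

locale cat_functor = A: category A + B: category B
  for A :: "('o, 'm) cat" and B :: "('p, 'n) cat" +
  fixes Fo :: "'o \<Rightarrow> 'p" and Fm :: "'m \<Rightarrow> 'n"
  assumes obj: "x \<in> Obj A \<Longrightarrow> Fo x \<in> Obj B"
    and arr: "f \<in> hom A x y \<Longrightarrow> Fm f \<in> hom B (Fo x) (Fo y)"
    and preserves_id: "x \<in> Obj A \<Longrightarrow> Fm (Id A x) = Id B (Fo x)"
    and preserves_comp: "\<lbrakk>f \<in> hom A x y; g \<in> hom A y z\<rbrakk>
      \<Longrightarrow> Fm (Comp A g f) = Comp B (Fm g) (Fm f)"

text \<open>An object of the slice is an arrow \<open>f\<close> with codomain \<open>x\<close>; an arrow from \<open>f\<close> to \<open>g\<close> is
  an \<open>h\<close> with \<open>g \<circ> h = f\<close>, stored as \<open>(f, h, g)\<close> so that it determines its source and target.\<close>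

definition slice :: "('o, 'm) cat \<Rightarrow> 'o \<Rightarrow> ('m, 'm \<times> 'm \<times> 'm) cat" where
  "slice C x = \<lparr>
     Obj = {f \<in> Arr C. Cod C f = x},
     Arr = {(f, h, g). f \<in> Arr C \<and> Cod C f = x \<and> g \<in> Arr C \<and> Cod C g = x \<and>
                       h \<in> hom C (Dom C f) (Dom C g) \<and> Comp C g h = f},
     Dom = (\<lambda>(f, h, g). f),
     Cod = (\<lambda>(f, h, g). g),
     Id = (\<lambda>f. (f, Id C (Dom C f), f)),
     Comp = (\<lambda>(f', h', g') (f, h, g). (f, Comp C h' h, g'))\<rparr>"

lemma (in category) category_slice: "category (slice C x)"
proof
  fix w x' y z f g h
  assume "f \<in> hom (slice C x) w x'" "g \<in> hom (slice C x) x' y" "h \<in> hom (slice C x) y z"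
  then show "Comp (slice C x) h (Comp (slice C x) g f) = Comp (slice C x) (Comp (slice C x) h g) f"
    by (auto simp: slice_def hom_def intro!: comp_assoc)
next
  fix f y z g w
  assume "f \<in> hom (slice C x) y z" "g \<in> hom (slice C x) z w"
  then obtain a b where f: "f = (y, a, z)" and g: "g = (z, b, w)"
    and y: "y \<in> Arr C" "Cod C y = x" and z: "z \<in> Arr C" "Cod C z = x"
    and w: "w \<in> Arr C" "Cod C w = x"
    and a: "a \<in> hom C (Dom C y) (Dom C z)" "Comp C z a = y"
    and b: "b \<in> hom C (Dom C z) (Dom C w)" "Comp C w b = z"
    by (auto simp: slice_def hom_def)
  have "Comp C w (Comp C b a) = y"
    using comp_assoc[OF a(1) b(1), of w x] a b w by (simp add: hom_def)
  moreover have "Comp C b a \<in> hom C (Dom C y) (Dom C w)"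
    using comp_hom[OF a(1) b(1)] .
  ultimately show "Comp (slice C x) g f \<in> hom (slice C x) y w"
    using f g y z w by (simp add: slice_def hom_def)
next
  fix f assume "f \<in> Obj (slice C x)"
  then have f: "f \<in> Arr C" "Cod C f = x"
    by (auto simp: slice_def)
  have "Id C (Dom C f) \<in> hom C (Dom C f) (Dom C f)"
    using id_hom dom_obj f by blast
  moreover have "Comp C f (Id C (Dom C f)) = f"
    using comp_id_right f by (auto simp: hom_def)
  ultimately show "Id (slice C x) f \<in> hom (slice C x) f f"
    using f by (simp add: slice_def hom_def)
qed (auto simp: slice_def hom_def comp_id_right comp_id_left)

lemma (in category) functor_dom:
  "cat_functor (slice C x) C (Dom C) (\<lambda>(f, h, g). h)"
proof -
  interpret S: category "slice C x" by (rule category_slice)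
  show ?thesis
    by unfold_locales (auto simp: slice_def hom_def dom_obj)
qed

section \<open>Posets and the poset reflection\<close>

text \<open>As in \<^theory>\<open>HOL.Order_Relation\<close>, a poset is a relation \<open>r\<close> with \<^term>\<open>Partial_order r\<close>,
  its underlying set being \<^term>\<open>Field r\<close>; \<^term>\<open>compat r s f\<close> says that \<open>f\<close> is order-preserving.\<close>

definition mutual_class :: "'a rel \<Rightarrow> 'a \<Rightarrow> 'a set" where
  "mutual_class r a = (r \<inter> r\<inverse>) `` {a}"

definition poset_of_preorder :: "'a rel \<Rightarrow> 'a set rel" where
  "poset_of_preorder r = {(mutual_class r a, mutual_class r b) |a b. (a, b) \<in> r}"

lemma mutual_class_eq_iff:
  assumes "Preorder r" "a \<in> Field r" "b \<in> Field r"
  shows "mutual_class r a = mutual_class r b \<longleftrightarrow> (a, b) \<in> r \<and> (b, a) \<in> r"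
proof
  assume "mutual_class r a = mutual_class r b"
  moreover have "a \<in> mutual_class r a"
    using assms by (auto simp: mutual_class_def preorder_on_def refl_on_def)
  ultimately show "(a, b) \<in> r \<and> (b, a) \<in> r"
    by (auto simp: mutual_class_def)
next
  assume "(a, b) \<in> r \<and> (b, a) \<in> r"
  then show "mutual_class r a = mutual_class r b"
    using assms unfolding mutual_class_def preorder_on_def
    by (auto dest: transD)
qed

lemma poset_of_preorder_iff:
  assumes "Preorder r" "a \<in> Field r" "b \<in> Field r"
  shows "(mutual_class r a, mutual_class r b) \<in> poset_of_preorder r \<longleftrightarrow> (a, b) \<in> r"
proof
  assume "(mutual_class r a, mutual_class r b) \<in> poset_of_preorder r"
  then obtain a' b' where eq: "mutual_class r a = mutual_class r a'"
    "mutual_class r b = mutual_class r b'" and r: "(a', b') \<in> r"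
    by (auto simp: poset_of_preorder_def)
  from r have "a' \<in> Field r" "b' \<in> Field r"
    by (auto simp: Field_def)
  with eq assms have "(a, a') \<in> r" "(b', b) \<in> r"
    by (simp_all add: mutual_class_eq_iff)
  with r assms(1) show "(a, b) \<in> r"
    unfolding preorder_on_def by (meson transD)
qed (auto simp: poset_of_preorder_def)

lemma Field_poset_of_preorder:
  "Field (poset_of_preorder r) = mutual_class r ` Field r"
  unfolding poset_of_preorder_def Field_def by blast

lemma Partial_order_poset_of_preorder:
  assumes "Preorder r"
  shows "Partial_order (poset_of_preorder r)"
proof -
  let ?P = "poset_of_preorder r"
  have "refl_on (Field ?P) ?P"
  proof
    fix X assume "X \<in> Field ?P"
    then obtain a where "a \<in> Field r" "X = mutual_class r a"
      by (auto simp: Field_poset_of_preorder)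
    then show "(X, X) \<in> ?P"
      using assms by (simp add: poset_of_preorder_iff) (auto simp: preorder_on_def refl_on_def)
  qed
  moreover have "?P \<subseteq> Field ?P \<times> Field ?P"
    by (auto simp: Field_def)
  moreover have "trans ?P"
  proof
    fix X Y Z assume XY: "(X, Y) \<in> ?P" and YZ: "(Y, Z) \<in> ?P"
    then have "X \<in> Field ?P" "Y \<in> Field ?P" "Z \<in> Field ?P"
      by (auto simp: Field_def)
    then obtain a b c where "a \<in> Field r" "b \<in> Field r" "c \<in> Field r"
      "X = mutual_class r a" "Y = mutual_class r b" "Z = mutual_class r c"
      by (auto simp: Field_poset_of_preorder)
    with XY YZ assms show "(X, Z) \<in> ?P"
      by (simp add: poset_of_preorder_iff) (auto simp: preorder_on_def dest: transD)
  qed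
  moreover have "antisym ?P"
  proof
    fix X Y assume XY: "(X, Y) \<in> ?P" and YX: "(Y, X) \<in> ?P"
    then have "X \<in> Field ?P" "Y \<in> Field ?P"
      by (auto simp: Field_def)
    then obtain a b where "a \<in> Field r" "b \<in> Field r"
      "X = mutual_class r a" "Y = mutual_class r b"
      by (auto simp: Field_poset_of_preorder)
    with XY YX assms show "X = Y"
      by (simp add: poset_of_preorder_iff mutual_class_eq_iff)
  qed
  ultimately show ?thesis
    by (simp add: partial_order_on_def preorder_on_def)
qed

definition arrow_rel :: "('o, 'm) cat \<Rightarrow> 'o rel" where
  "arrow_rel C = {(x, y). x \<in> Obj C \<and> y \<in> Obj C \<and> hom C x y \<noteq> {}}"

lemma (in category) Field_arrow_rel [simp]: "Field (arrow_rel C) = Obj C"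
  using id_hom by (fastforce simp: arrow_rel_def Field_def)

lemma (in category) Preorder_arrow_rel: "Preorder (arrow_rel C)"
proof -
  have "trans (arrow_rel C)"
    using comp_hom by (fastforce simp: arrow_rel_def intro!: transI)
  moreover have "refl_on (Obj C) (arrow_rel C)"
    using id_hom by (auto simp: arrow_rel_def refl_on_def)
  ultimately show ?thesis
    by (auto simp: preorder_on_def) (auto simp: arrow_rel_def)
qed

definition poset_reflection :: "('o, 'm) cat \<Rightarrow> 'o set rel" where
  "poset_reflection C = poset_of_preorder (arrow_rel C)"

definition obj_class :: "('o, 'm) cat \<Rightarrow> 'o \<Rightarrow> 'o set" where
  "obj_class C x = mutual_class (arrow_rel C) x"

text \<open>The action on a functor with object map \<open>Fo\<close> and target \<open>B\<close>. All the classes in the union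
  coincide when its argument is an element of the poset reflection of the source.\<close>

definition reflection_map :: "('p, 'n) cat \<Rightarrow> ('o \<Rightarrow> 'p) \<Rightarrow> 'o set \<Rightarrow> 'p set" where
  "reflection_map B Fo X = (\<Union>x\<in>X. obj_class B (Fo x))"

lemma (in cat_functor) arrow_rel_map:
  "(x, y) \<in> arrow_rel A \<Longrightarrow> (Fo x, Fo y) \<in> arrow_rel B"
  using obj arr by (fastforce simp: arrow_rel_def)

lemma (in cat_functor) reflection_map_class:
  assumes "x \<in> Obj A"
  shows "reflection_map B Fo (obj_class A x) = obj_class B (Fo x)"
proof -
  have eq: "obj_class B (Fo y) = obj_class B (Fo x)" if "y \<in> obj_class A x" for y
  proof -
    from that have "(x, y) \<in> arrow_rel A" "(y, x) \<in> arrow_rel A"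
      by (auto simp: obj_class_def mutual_class_def)
    then have "(Fo x, Fo y) \<in> arrow_rel B" "(Fo y, Fo x) \<in> arrow_rel B"
      by (auto intro: arrow_rel_map)
    then show ?thesis
      unfolding obj_class_def
      by (subst mutual_class_eq_iff[OF B.Preorder_arrow_rel]) (blast intro: FieldI1)+
  qed
  have "obj_class A x \<noteq> {}"
    using assms A.id_hom by (auto simp: obj_class_def mutual_class_def arrow_rel_def)
  then show ?thesis
    unfolding reflection_map_def by (rule SUP_eq_const) (rule eq)
qed

lemma (in cat_functor) compat_reflection_map:
  "compat (poset_reflection A) (poset_reflection B) (reflection_map B Fo)"
  unfolding compat_def
proof (intro allI impI)
  fix X Y assume "(X, Y) \<in> poset_reflection A"
  then obtain x y where xy: "X = obj_class A x" "Y = obj_class A y" "(x, y) \<in> arrow_rel A"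
    by (auto simp: poset_reflection_def poset_of_preorder_def obj_class_def)
  then have "x \<in> Obj A" "y \<in> Obj A"
    by (auto simp: arrow_rel_def)
  with xy show "(reflection_map B Fo X, reflection_map B Fo Y) \<in> poset_reflection B"
    using arrow_rel_map[OF xy(3)]
    unfolding poset_reflection_def poset_of_preorder_def
    by (auto simp: reflection_map_class) (auto simp: obj_class_def)
qed

section \<open>Pushouts of posets\<close>

text \<open>The pushout of \<open>f : t \<rightarrow> r\<close> along \<open>g : t \<rightarrow> s\<close>: the poset associated with the preorder
  on the disjoint union generated by \<open>r\<close>, \<open>s\<close> and \<open>f c \<sim> g c\<close>. The universal property is
  \<open>pushout_cocone\<close> and \<open>pushout_universal\<close> below.\<close>

definition pushout_gen ::
    "'c rel \<Rightarrow> 'a rel \<Rightarrow> 'b rel \<Rightarrow> ('c \<Rightarrow> 'a) \<Rightarrow> ('c \<Rightarrow> 'b) \<Rightarrow> ('a + 'b) rel" where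
  "pushout_gen t r s f g =
     {(Inl a, Inl a') |a a'. (a, a') \<in> r} \<union> {(Inr b, Inr b') |b b'. (b, b') \<in> s} \<union>
     {(Inl (f c), Inr (g c)) |c. c \<in> Field t} \<union> {(Inr (g c), Inl (f c)) |c. c \<in> Field t}"

definition pushout ::
    "'c rel \<Rightarrow> 'a rel \<Rightarrow> 'b rel \<Rightarrow> ('c \<Rightarrow> 'a) \<Rightarrow> ('c \<Rightarrow> 'b) \<Rightarrow> ('a + 'b) set rel" where
  "pushout t r s f g = poset_of_preorder ((pushout_gen t r s f g)\<^sup>+)"

definition pushout_inl ::
    "'c rel \<Rightarrow> 'a rel \<Rightarrow> 'b rel \<Rightarrow> ('c \<Rightarrow> 'a) \<Rightarrow> ('c \<Rightarrow> 'b) \<Rightarrow> 'a \<Rightarrow> ('a + 'b) set" where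
  "pushout_inl t r s f g a = mutual_class ((pushout_gen t r s f g)\<^sup>+) (Inl a)"

definition pushout_inr ::
    "'c rel \<Rightarrow> 'a rel \<Rightarrow> 'b rel \<Rightarrow> ('c \<Rightarrow> 'a) \<Rightarrow> ('c \<Rightarrow> 'b) \<Rightarrow> 'b \<Rightarrow> ('a + 'b) set" where
  "pushout_inr t r s f g b = mutual_class ((pushout_gen t r s f g)\<^sup>+) (Inr b)"

context
  fixes t :: "'c rel" and r :: "'a rel" and s :: "'b rel" and f g
  assumes t: "Partial_order t" and r: "Partial_order r" and s: "Partial_order s"
    and f: "compat t r f" and g: "compat t s g"
begin

lemma pushout_map_Field: "c \<in> Field t \<Longrightarrow> f c \<in> Field r \<and> g c \<in> Field s"
  using f g unfolding compat_def Field_def by blast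

lemma Field_pushout_gen: "Field ((pushout_gen t r s f g)\<^sup>+) = Field r <+> Field s"
proof -
  have "Field (pushout_gen t r s f g) = Field r <+> Field s"
  proof (intro equalityI subsetI)
    fix p assume "p \<in> Field (pushout_gen t r s f g)"
    then obtain q where "(p, q) \<in> pushout_gen t r s f g \<or> (q, p) \<in> pushout_gen t r s f g"
      unfolding Field_def by blast
    then show "p \<in> Field r <+> Field s"
      using pushout_map_Field
      by (auto simp: pushout_gen_def intro: FieldI1 FieldI2)
  next
    fix p assume "p \<in> Field r <+> Field s"
    then have "(p, p) \<in> pushout_gen t r s f g"
      using r s by (auto simp: pushout_gen_def partial_order_on_def preorder_on_def refl_on_def)
    then show "p \<in> Field (pushout_gen t r s f g)"
      by (rule FieldI1)
  qed
  then show ?thesis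
    by (simp add: Field_def)
qed

lemma Preorder_pushout_gen: "Preorder ((pushout_gen t r s f g)\<^sup>+)"
proof -
  have "refl_on (Field r <+> Field s) (pushout_gen t r s f g)"
    using r s by (auto simp: refl_on_def pushout_gen_def partial_order_on_def preorder_on_def)
  then have "refl_on (Field r <+> Field s) ((pushout_gen t r s f g)\<^sup>+)"
    by (auto simp: refl_on_def)
  then have "Refl ((pushout_gen t r s f g)\<^sup>+)"
    by (simp only: Field_pushout_gen)
  moreover have "(pushout_gen t r s f g)\<^sup>+ \<subseteq>
      Field ((pushout_gen t r s f g)\<^sup>+) \<times> Field ((pushout_gen t r s f g)\<^sup>+)"
    by (intro subrelI SigmaI) (rule FieldI1 FieldI2, assumption)+
  ultimately show ?thesis
    by (simp only: preorder_on_def trans_trancl simp_thms)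
qed

lemma Partial_order_pushout: "Partial_order (pushout t r s f g)"
  unfolding pushout_def by (rule Partial_order_poset_of_preorder[OF Preorder_pushout_gen])

lemma Field_pushout:
  "Field (pushout t r s f g) = pushout_inl t r s f g ` Field r \<union> pushout_inr t r s f g ` Field s"
  unfolding pushout_def Field_poset_of_preorder Field_pushout_gen
  by (auto simp: pushout_inl_def pushout_inr_def image_iff Plus_def)

lemma pushout_cocone:
  "compat r (pushout t r s f g) (pushout_inl t r s f g)"
  "compat s (pushout t r s f g) (pushout_inr t r s f g)"
  "c \<in> Field t \<Longrightarrow> pushout_inl t r s f g (f c) = pushout_inr t r s f g (g c)"
proof -
  show "compat r (pushout t r s f g) (pushout_inl t r s f g)"
    unfolding compat_def pushout_def poset_of_preorder_def pushout_inl_def mem_Collect_eq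
    by (intro allI impI exI conjI refl r_into_trancl) (auto simp: pushout_gen_def)
  show "compat s (pushout t r s f g) (pushout_inr t r s f g)"
    unfolding compat_def pushout_def poset_of_preorder_def pushout_inr_def mem_Collect_eq
    by (intro allI impI exI conjI refl r_into_trancl) (auto simp: pushout_gen_def)
  assume c: "c \<in> Field t"
  then have "(Inl (f c), Inr (g c)) \<in> (pushout_gen t r s f g)\<^sup>+"
    "(Inr (g c), Inl (f c)) \<in> (pushout_gen t r s f g)\<^sup>+"
    by (auto simp: pushout_gen_def intro!: r_into_trancl)
  then show "pushout_inl t r s f g (f c) = pushout_inr t r s f g (g c)"
    unfolding pushout_inl_def pushout_inr_def
    using pushout_map_Field[OF c]
    by (subst mutual_class_eq_iff[OF Preorder_pushout_gen]) (auto simp: Field_pushout_gen)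
qed

lemma pushout_universal:
  fixes d :: "'d rel"
  assumes d: "Partial_order d" and h: "compat r d h" and k: "compat s d k"
    and hk: "\<And>c. c \<in> Field t \<Longrightarrow> h (f c) = k (g c)"
  shows "\<exists>u. compat (pushout t r s f g) d u \<and>
    (\<forall>a\<in>Field r. u (pushout_inl t r s f g a) = h a) \<and>
    (\<forall>b\<in>Field s. u (pushout_inr t r s f g b) = k b) \<and>
    (\<forall>v. (\<forall>a\<in>Field r. v (pushout_inl t r s f g a) = h a) \<and>
         (\<forall>b\<in>Field s. v (pushout_inr t r s f g b) = k b)
         \<longrightarrow> (\<forall>p\<in>Field (pushout t r s f g). v p = u p))"
proof -
  let ?R = "(pushout_gen t r s f g)\<^sup>+"
  define w where "w = case_sum h k"
  have td: "trans d" and rd: "\<And>x. x \<in> Field d \<Longrightarrow> (x, x) \<in> d" and ad: "antisym d"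
    using d by (auto simp: partial_order_on_def preorder_on_def refl_on_def)
  have step: "(w p, w q) \<in> d" if "(p, q) \<in> pushout_gen t r s f g" for p q
  proof -
    have "k (g c) \<in> Field d" if "c \<in> Field t" for c
      using k pushout_map_Field[OF that] by (auto simp: compat_def Field_def)
    with that show ?thesis
      using h k hk rd by (auto simp: pushout_gen_def w_def compat_def)
  qed
  have w: "(w p, w q) \<in> d" if "(p, q) \<in> ?R" for p q
    using that by (induction rule: trancl_induct) (auto intro: step transD[OF td])
  define u where "u P = w (SOME p. p \<in> Field ?R \<and> P = mutual_class ?R p)" for P
  have u: "u (mutual_class ?R p) = w p" if "p \<in> Field ?R" for p
  proof -
    define q where "q = (SOME q. q \<in> Field ?R \<and> mutual_class ?R p = mutual_class ?R q)"
    have "q \<in> Field ?R \<and> mutual_class ?R p = mutual_class ?R q"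
      unfolding q_def by (rule someI[of _ p]) (use that in simp)
    then have "(p, q) \<in> ?R" "(q, p) \<in> ?R"
      using mutual_class_eq_iff[OF Preorder_pushout_gen that] by blast+
    then have "w q = w p"
      using w ad by (meson antisymD)
    then show ?thesis
      by (simp add: u_def q_def)
  qed
  show ?thesis
  proof (intro exI[of _ u] conjI allI impI ballI)
    show "compat (pushout t r s f g) d u"
      unfolding compat_def
    proof (intro allI impI)
      fix P Q assume "(P, Q) \<in> pushout t r s f g"
      then obtain p q where pq: "P = mutual_class ?R p" "Q = mutual_class ?R q" "(p, q) \<in> ?R"
        by (auto simp: pushout_def poset_of_preorder_def)
      then have "p \<in> Field ?R" "q \<in> Field ?R"
        unfolding Field_def by blast+
      then show "(u P, u Q) \<in> d"
        using pq w u by simp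
    qed
    show l: "u (pushout_inl t r s f g a) = h a" if "a \<in> Field r" for a
      using that u[of "Inl a"] by (auto simp: pushout_inl_def w_def Field_pushout_gen)
    show r: "u (pushout_inr t r s f g b) = k b" if "b \<in> Field s" for b
      using that u[of "Inr b"] by (auto simp: pushout_inr_def w_def Field_pushout_gen)
    show "v p = u p" if "(\<forall>a\<in>Field r. v (pushout_inl t r s f g a) = h a) \<and>
      (\<forall>b\<in>Field s. v (pushout_inr t r s f g b) = k b)" "p \<in> Field (pushout t r s f g)" for v p
      using that(2) unfolding Field_pushout
      by (elim UnE imageE) (simp_all add: that(1) l r)
  qed
qed

end

section \<open>The zeroth homotopy poset of an object\<close>

abbreviation point_poset :: "unit rel" where
  "point_poset \<equiv> {((), ())}"

definition homotopy_poset :: "('o, 'm) cat \<Rightarrow> 'o \<Rightarrow> ('o set + unit) set rel" where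
  "homotopy_poset C x =
     pushout (poset_reflection (slice C x)) (poset_reflection C) point_poset
       (reflection_map C (Dom C)) (\<lambda>_. ())"

definition homotopy_base :: "('o, 'm) cat \<Rightarrow> 'o \<Rightarrow> ('o set + unit) set" where
  "homotopy_base C x =
     pushout_inr (poset_reflection (slice C x)) (poset_reflection C) point_poset
       (reflection_map C (Dom C)) (\<lambda>_. ()) ()"

definition homotopy_class :: "('o, 'm) cat \<Rightarrow> 'o \<Rightarrow> 'o \<Rightarrow> ('o set + unit) set" where
  "homotopy_class C x y =
     pushout_inl (poset_reflection (slice C x)) (poset_reflection C) point_poset
       (reflection_map C (Dom C)) (\<lambda>_. ()) (obj_class C y)"

context category
begin

lemma Partial_order_poset_reflection: "Partial_order (poset_reflection C)"
  unfolding poset_reflection_def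
  by (rule Partial_order_poset_of_preorder[OF Preorder_arrow_rel])

lemma Field_poset_reflection: "Field (poset_reflection C) = obj_class C ` Obj C"
  by (simp add: poset_reflection_def Field_poset_of_preorder obj_class_def)

lemma poset_reflection_iff:
  "\<lbrakk>y \<in> Obj C; z \<in> Obj C\<rbrakk> \<Longrightarrow>
    (obj_class C y, obj_class C z) \<in> poset_reflection C \<longleftrightarrow> hom C y z \<noteq> {}"
  by (auto simp: poset_reflection_def obj_class_def poset_of_preorder_iff[OF Preorder_arrow_rel])
    (auto simp: arrow_rel_def)

lemma homotopy_span:
  "Partial_order (poset_reflection (slice C x))" "Partial_order point_poset"
  "compat (poset_reflection (slice C x)) (poset_reflection C) (reflection_map C (Dom C))"
  "compat (poset_reflection (slice C x)) point_poset (\<lambda>_. ())"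
proof -
  show "Partial_order (poset_reflection (slice C x))"
    by (rule category.Partial_order_poset_reflection[OF category_slice])
  show "Partial_order point_poset"
    by (simp add: partial_order_on_def preorder_on_def refl_on_def Field_def trans_def antisym_def)
  show "compat (poset_reflection (slice C x)) (poset_reflection C) (reflection_map C (Dom C))"
    by (rule cat_functor.compat_reflection_map[OF functor_dom])
  show "compat (poset_reflection (slice C x)) point_poset (\<lambda>_. ())"
    by (simp add: compat_def)
qed

lemma Partial_order_homotopy_poset: "Partial_order (homotopy_poset C x)"
  unfolding homotopy_poset_def
  by (rule Partial_order_pushout[OF homotopy_span(1) Partial_order_poset_reflection
    homotopy_span(2-4)])

lemma slice_image:
  "reflection_map C (Dom C) ` Field (poset_reflection (slice C x)) =
     obj_class C ` {y \<in> Obj C. hom C y x \<noteq> {}}"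
proof -
  interpret S: category "slice C x" by (rule category_slice)
  interpret F: cat_functor "slice C x" C "Dom C" "\<lambda>(f, h, g). h" by (rule functor_dom)
  have "Dom C ` Obj (slice C x) = {y \<in> Obj C. hom C y x \<noteq> {}}"
    by (auto simp: slice_def hom_def dom_obj)
  moreover have "reflection_map C (Dom C) ` Field (poset_reflection (slice C x)) =
      obj_class C ` Dom C ` Obj (slice C x)"
    unfolding S.Field_poset_reflection image_image
    by (rule image_cong[OF refl]) (rule F.reflection_map_class)
  ultimately show ?thesis
    by simp
qed

lemma homotopy_poset_explicit:
  assumes x: "x \<in> Obj C"
  shows Field_homotopy_poset: "Field (homotopy_poset C x) =
      insert (homotopy_base C x) (homotopy_class C x ` {y \<in> Obj C. hom C y x = {}})"
    and homotopy_class_eq_base: "\<lbrakk>y \<in> Obj C; hom C y x \<noteq> {}\<rbrakk> \<Longrightarrow>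
      homotopy_class C x y = homotopy_base C x"
    and homotopy_base_le_iff: "\<lbrakk>y \<in> Obj C; hom C y x = {}\<rbrakk> \<Longrightarrow>
      (homotopy_base C x, homotopy_class C x y) \<in> homotopy_poset C x \<longleftrightarrow>
      (\<exists>z\<in>Obj C. hom C z x \<noteq> {} \<and> hom C z y \<noteq> {})"
    and homotopy_not_le_base: "\<lbrakk>y \<in> Obj C; hom C y x = {}\<rbrakk> \<Longrightarrow>
      (homotopy_class C x y, homotopy_base C x) \<notin> homotopy_poset C x"
    and homotopy_le_iff: "\<lbrakk>y \<in> Obj C; hom C y x = {}; z \<in> Obj C; hom C z x = {}\<rbrakk> \<Longrightarrow>
      (homotopy_class C x y, homotopy_class C x z) \<in> homotopy_poset C x \<longleftrightarrow> hom C y z \<noteq> {}"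
proof -
  let ?S = "poset_reflection (slice C x)"
  let ?f = "reflection_map C (Dom C)"
  let ?gen = "pushout_gen ?S (poset_reflection C) point_poset ?f (\<lambda>_. ())"
  define H where "H = poset_reflection C"
  define D where "D = obj_class C ` {y \<in> Obj C. hom C y x \<noteq> {}}"
  note po = homotopy_span(1)[of x] Partial_order_poset_reflection homotopy_span(2)
    homotopy_span(3,4)[of x]
  note pre = Preorder_pushout_gen[OF po] and field = Field_pushout_gen[OF po]
  have gen: "?gen = {(Inl a, Inl b) |a b. (a, b) \<in> H} \<union> {(Inr (), Inr ())} \<union>
      {(Inl a, Inr ()) |a. a \<in> D} \<union> {(Inr (), Inl a) |a. a \<in> D}"
    unfolding pushout_gen_def H_def D_def slice_image[symmetric] by auto
  have tH: "trans H" and rH: "\<And>a. a \<in> Field H \<Longrightarrow> (a, a) \<in> H"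
    using Partial_order_poset_reflection
    by (auto simp: H_def partial_order_on_def preorder_on_def refl_on_def)
  have DF: "D \<subseteq> Field H"
    by (auto simp: D_def H_def Field_poset_reflection)
  have rD: "(c, c) \<in> H" if "c \<in> D" for c
    using that DF rH by blast
  have class_D: "obj_class C y \<in> D \<longleftrightarrow> hom C y x \<noteq> {}" if y: "y \<in> Obj C" for y
  proof
    assume "obj_class C y \<in> D"
    then obtain z where z: "z \<in> Obj C" "hom C z x \<noteq> {}" "obj_class C y = obj_class C z"
      by (auto simp: D_def)
    then have "hom C y z \<noteq> {}"
      using poset_reflection_iff[OF y z(1)] poset_reflection_iff[OF z(1) z(1)] id_hom by auto
    then show "hom C y x \<noteq> {}"
      using z comp_hom by fastforce
  qed (use y in \<open>auto simp: D_def\<close>)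
  have D_down: "a \<in> D" if "(a, b) \<in> H" "b \<in> D" for a b
  proof -
    from that obtain y where y: "y \<in> Obj C" "a = obj_class C y"
      by (auto simp: H_def Field_poset_reflection dest!: FieldI1)
    from that obtain z where z: "z \<in> Obj C" "hom C z x \<noteq> {}" "b = obj_class C z"
      by (auto simp: D_def)
    from that y z have "hom C y z \<noteq> {}"
      by (simp add: H_def poset_reflection_iff)
    with y z comp_hom have "hom C y x \<noteq> {}"
      by fastforce
    with y show ?thesis
      by (auto simp: D_def)
  qed
  define E where "E p q = (case (p, q) of
      (Inl a, Inl b) \<Rightarrow> (a, b) \<in> H \<or> (a \<in> D \<and> (\<exists>c\<in>D. (c, b) \<in> H))
    | (Inl a, Inr _) \<Rightarrow> a \<in> D
    | (Inr _, Inl b) \<Rightarrow> (\<exists>c\<in>D. (c, b) \<in> H)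
    | (Inr _, Inr _) \<Rightarrow> True)" for p q :: "'o set + unit"
  have genE: "E p q" if "(p, q) \<in> ?gen\<^sup>+" for p q
    using that
  proof (induction rule: trancl_induct)
    case (base q)
    then show ?case
      unfolding gen by (auto simp: E_def) (use rD in blast)+
  next
    case (step q q')
    have E: "E p q" by (rule step.IH)
    from step.hyps(2) consider (order) a b where "q = Inl a" "q' = Inl b" "(a, b) \<in> H"
      | (point) "q = Inr ()" "q' = Inr ()"
      | (into) a where "q = Inl a" "q' = Inr ()" "a \<in> D"
      | (out) a where "q = Inr ()" "q' = Inl a" "a \<in> D"
      unfolding gen by blast
    then show ?case
    proof cases
      case order
      with E transD[OF tH] show ?thesis
        by (cases p; simp add: E_def) blast+
    next
      case point
      with E show ?thesis by simp
    next
      case into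
      with E D_down show ?thesis
        by (cases p; simp add: E_def) blast
    next
      case out
      with E rD show ?thesis
        by (cases p; simp add: E_def) blast+
    qed
  qed
  have Egen: "(Inr (), Inl b) \<in> ?gen\<^sup>+" if "c \<in> D" "(c, b) \<in> H" for c b
  proof -
    have "(Inr (), Inl c) \<in> ?gen" "(Inl c, Inl b) \<in> ?gen"
      using that unfolding gen by auto
    then show ?thesis by (rule trancl_trans[OF r_into_trancl r_into_trancl])
  qed
  have le: "(mutual_class (?gen\<^sup>+) p, mutual_class (?gen\<^sup>+) q) \<in> homotopy_poset C x
      \<longleftrightarrow> (p, q) \<in> ?gen\<^sup>+"
    if "p \<in> Field H <+> UNIV" "q \<in> Field H <+> UNIV" for p q
    unfolding homotopy_poset_def pushout_def
    by (rule poset_of_preorder_iff[OF pre]; unfold field)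
      (use that in \<open>auto simp: H_def Field_def[of point_poset]\<close>)
  have cls: "obj_class C y \<in> Field H" if "y \<in> Obj C" for y
    using that by (auto simp: H_def Field_poset_reflection)
  have cl: "homotopy_class C x y = mutual_class (?gen\<^sup>+) (Inl (obj_class C y))" for y
    by (simp add: homotopy_class_def pushout_inl_def)
  have ba: "homotopy_base C x = mutual_class (?gen\<^sup>+) (Inr ())"
    by (simp add: homotopy_base_def pushout_inr_def)
  show base: "homotopy_class C x y = homotopy_base C x" if "y \<in> Obj C" "hom C y x \<noteq> {}" for y
  proof -
    have "(Inl (obj_class C y), Inr ()) \<in> ?gen" "(Inr (), Inl (obj_class C y)) \<in> ?gen"
      using that class_D unfolding gen by auto
    then have "(Inl (obj_class C y), Inr ()) \<in> ?gen\<^sup>+" "(Inr (), Inl (obj_class C y)) \<in> ?gen\<^sup>+"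
      by auto
    then show ?thesis
      unfolding cl ba using FieldI1 FieldI2
      by (subst mutual_class_eq_iff[OF pre]) fastforce+
  qed
  show "Field (homotopy_poset C x) =
      insert (homotopy_base C x) (homotopy_class C x ` {y \<in> Obj C. hom C y x = {}})"
  proof -
    have "Field (homotopy_poset C x) = insert (homotopy_base C x) (homotopy_class C x ` Obj C)"
      unfolding homotopy_poset_def Field_pushout[OF po] Field_poset_reflection
      by (auto simp: homotopy_base_def homotopy_class_def Field_def)
    also have "\<dots> = insert (homotopy_base C x) (homotopy_class C x ` {y \<in> Obj C. hom C y x = {}})"
      (is "_ = ?R")
    proof (rule equalityI)
      have "homotopy_class C x y \<in> ?R" if "y \<in> Obj C" for y
        using that by (cases "hom C y x = {}") (simp_all add: base)
      then have "homotopy_class C x ` Obj C \<subseteq> ?R"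
        by (rule image_subsetI)
      then show "insert (homotopy_base C x) (homotopy_class C x ` Obj C) \<subseteq> ?R"
        by (rule insert_subsetI[OF insertI1])
      show "?R \<subseteq> insert (homotopy_base C x) (homotopy_class C x ` Obj C)"
        by (intro insert_mono image_mono) simp
    qed
    finally show ?thesis .
  qed
  show "(homotopy_base C x, homotopy_class C x y) \<in> homotopy_poset C x \<longleftrightarrow>
      (\<exists>z\<in>Obj C. hom C z x \<noteq> {} \<and> hom C z y \<noteq> {})" if y: "y \<in> Obj C" "hom C y x = {}" for y
  proof -
    have "(homotopy_base C x, homotopy_class C x y) \<in> homotopy_poset C x \<longleftrightarrow>
        (Inr (), Inl (obj_class C y)) \<in> ?gen\<^sup>+"
      unfolding cl ba by (rule le) (use cls y in auto)
    also have "\<dots> \<longleftrightarrow> (\<exists>c\<in>D. (c, obj_class C y) \<in> H)"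
    proof
      assume "(Inr (), Inl (obj_class C y)) \<in> ?gen\<^sup>+"
      from genE[OF this] show "\<exists>c\<in>D. (c, obj_class C y) \<in> H"
        by (simp add: E_def)
    next
      assume "\<exists>c\<in>D. (c, obj_class C y) \<in> H"
      then show "(Inr (), Inl (obj_class C y)) \<in> ?gen\<^sup>+"
        by (blast intro: Egen)
    qed
    also have "\<dots> \<longleftrightarrow> (\<exists>z\<in>Obj C. hom C z x \<noteq> {} \<and> hom C z y \<noteq> {})"
      using y by (auto simp: D_def H_def poset_reflection_iff)
    finally show ?thesis .
  qed
  show "(homotopy_class C x y, homotopy_base C x) \<notin> homotopy_poset C x"
    if y: "y \<in> Obj C" "hom C y x = {}" for y
  proof -
    have "(homotopy_class C x y, homotopy_base C x) \<in> homotopy_poset C x \<longleftrightarrow>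
        (Inl (obj_class C y), Inr ()) \<in> ?gen\<^sup>+"
      unfolding cl ba by (rule le) (use cls y in auto)
    moreover have "(Inl (obj_class C y), Inr ()) \<notin> ?gen\<^sup>+"
    proof
      assume "(Inl (obj_class C y), Inr ()) \<in> ?gen\<^sup>+"
      from genE[OF this] show False
        using y by (simp add: E_def class_D)
    qed
    ultimately show ?thesis
      by simp
  qed
  show "(homotopy_class C x y, homotopy_class C x z) \<in> homotopy_poset C x \<longleftrightarrow> hom C y z \<noteq> {}"
    if y: "y \<in> Obj C" "hom C y x = {}" and z: "z \<in> Obj C" "hom C z x = {}" for y z
  proof -
    have "(homotopy_class C x y, homotopy_class C x z) \<in> homotopy_poset C x \<longleftrightarrow>
        (Inl (obj_class C y), Inl (obj_class C z)) \<in> ?gen\<^sup>+"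
      unfolding cl by (rule le) (use cls y z in auto)
    also have "\<dots> \<longleftrightarrow> (obj_class C y, obj_class C z) \<in> H"
    proof
      assume "(Inl (obj_class C y), Inl (obj_class C z)) \<in> ?gen\<^sup>+"
      from genE[OF this] show "(obj_class C y, obj_class C z) \<in> H"
        using y by (simp add: E_def class_D)
    next
      assume "(obj_class C y, obj_class C z) \<in> H"
      then show "(Inl (obj_class C y), Inl (obj_class C z)) \<in> ?gen\<^sup>+"
        unfolding gen by (intro r_into_trancl) blast
    qed
    finally show ?thesis
      using y z by (simp add: H_def poset_reflection_iff)
  qed
qed

end

section \<open>Connected components and isomorphism of pointed sets\<close>

text \<open>Objects are connected if they are linked by a finite zigzag of arrows. Since
  \<^term>\<open>arrow_rel C\<close> is reflexive on objects, the transitive closure already is an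
  equivalence relation on \<^term>\<open>Obj C\<close>.\<close>

definition connected_rel :: "('o, 'm) cat \<Rightarrow> 'o rel" where
  "connected_rel C = (arrow_rel C \<union> (arrow_rel C)\<inverse>)\<^sup>+"

definition components :: "('o, 'm) cat \<Rightarrow> 'o set set" where
  "components C = Obj C // connected_rel C"

definition component :: "('o, 'm) cat \<Rightarrow> 'o \<Rightarrow> 'o set" where
  "component C x = connected_rel C `` {x}"

lemma (in category) equiv_connected_rel: "equiv (Obj C) (connected_rel C)"
proof -
  let ?S = "arrow_rel C \<union> (arrow_rel C)\<inverse>"
  have sub: "?S \<subseteq> Obj C \<times> Obj C"
    by (auto simp: arrow_rel_def)
  have "sym ?S"
    by (auto intro: symI)
  then have "sym (?S\<^sup>+)"
    by (rule sym_trancl)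
  moreover have "refl_on (Obj C) (?S\<^sup>+)"
    using id_hom by (auto simp: refl_on_def arrow_rel_def)
  moreover have "?S\<^sup>+ \<subseteq> Obj C \<times> Obj C"
    by (rule trancl_subset_Sigma[OF sub])
  ultimately show ?thesis
    by (auto simp: equiv_def connected_rel_def)
qed

definition discrete_poset :: "'a rel \<Rightarrow> bool" where
  "discrete_poset r \<longleftrightarrow> Partial_order r \<and> (\<forall>a b. (a, b) \<in> r \<longrightarrow> a = b)"

definition pointed_set_iso :: "'a set \<Rightarrow> 'a \<Rightarrow> 'b set \<Rightarrow> 'b \<Rightarrow> bool" where
  "pointed_set_iso A a B b \<longleftrightarrow> a \<in> A \<and> b \<in> B \<and> (\<exists>\<phi>. bij_betw \<phi> A B \<and> \<phi> a = b)"

end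

(* In a groupoid every arrow is invertible, so the existence of an arrow is a symmetric relation and
   coincides with connectedness. Hence the spans and arrows ordering the zeroth homotopy poset all
   reduce to this relation, and two objects have comparable classes there iff they are connected. *)

theory Submission
  imports Defs
begin

text \<open>Two maps on \<open>A\<close> with the same fibres have images that are both copies of
  the quotient of \<open>A\<close> by that common equivalence relation.\<close>

lemma bij_betw_images:
  assumes "\<And>a b. \<lbrakk>a \<in> A; b \<in> A\<rbrakk> \<Longrightarrow> f a = f b \<longleftrightarrow> g a = g b"
  shows "\<exists>\<phi>. bij_betw \<phi> (f ` A) (g ` A) \<and> (\<forall>a\<in>A. \<phi> (f a) = g a)"
proof (intro exI conjI ballI)
  \<comment> \<open>\<open>inv_into\<close> picks an arbitrary preimage; the equal fibres make the
    value of \<open>g\<close> there independent of the choice.\<close>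
  let ?\<phi> = "\<lambda>u. g (inv_into A f u)"
  show eq: "?\<phi> (f a) = g a" if "a \<in> A" for a
    using that assms[of "inv_into A f (f a)" a] by (simp add: inv_into_into f_inv_into_f)
  show "bij_betw ?\<phi> (f ` A) (g ` A)"
  proof (rule bij_betw_imageI)
    show "inj_on ?\<phi> (f ` A)"
      by (rule inj_onI) (auto simp: eq assms)
    show "?\<phi> ` f ` A = g ` A"
      unfolding image_image by (rule image_cong[OF refl eq])
  qed
qed

lemma (in category) homotopy_class_self:
  "x \<in> Obj C \<Longrightarrow> homotopy_class C x x = homotopy_base C x"
  by (rule homotopy_class_eq_base) (use id_hom in auto)

text \<open>Objects with an arrow to \<open>x\<close> collapse to the base point, which is itself
  the class of \<open>x\<close>. Every element is thus the class of some object, and the base point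
  needs no separate treatment.\<close>

lemma (in category) Field_homotopy_poset_image:
  assumes "x \<in> Obj C"
  shows "Field (homotopy_poset C x) = homotopy_class C x ` Obj C"
proof -
  have "homotopy_class C x y \<in> Field (homotopy_poset C x)" if "y \<in> Obj C" for y
    using that homotopy_class_eq_base[OF assms that]
    by (cases "hom C y x = {}") (auto simp: Field_homotopy_poset[OF assms])
  then show ?thesis
    using homotopy_class_self[OF assms] assms by (auto simp: Field_homotopy_poset[OF assms])
qed

context groupoid
begin

lemma hom_nonempty_sym:
  assumes "hom G x y \<noteq> {}"
  shows "hom G y x \<noteq> {}"
proof -
  obtain f where "f \<in> hom G x y"
    using assms by blast
  from inverse_ex[OF this] show ?thesis
    by blast
qed

lemma hom_nonempty_trans:
  assumes "hom G x y \<noteq> {}" and "hom G y z \<noteq> {}"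
  shows "hom G x z \<noteq> {}"
proof -
  obtain f g where "f \<in> hom G x y" "g \<in> hom G y z"
    using assms by blast
  from comp_hom[OF this] show ?thesis
    by blast
qed

text \<open>Inverses make \<open>arrow_rel G\<close> symmetric and composition makes it transitive,
  so closing under zigzags adds nothing.\<close>

lemma connected_rel_eq_arrow_rel: "connected_rel G = arrow_rel G"
proof -
  have "(arrow_rel G)\<inverse> = arrow_rel G"
    unfolding arrow_rel_def converse_unfold using hom_nonempty_sym by fast
  moreover have "trans (arrow_rel G)"
    using Preorder_arrow_rel by (simp add: preorder_on_def)
  ultimately show ?thesis
    by (simp add: connected_rel_def trancl_id)
qed

lemma component_eq_iff:
  assumes "y \<in> Obj G" "z \<in> Obj G"
  shows "component G y = component G z \<longleftrightarrow> hom G y z \<noteq> {}"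
  using eq_equiv_class_iff[OF equiv_connected_rel assms] assms
  by (simp add: component_def connected_rel_eq_arrow_rel arrow_rel_def)

text \<open>This extends the explicit order to objects that collapse to the base point, by cases on
  which of \<open>y\<close> and \<open>z\<close> do. Invertibility matters when \<open>y\<close>
  collapses, since the order then comes from spans rather than from arrows out of
  \<open>y\<close>.\<close>

lemma homotopy_class_le_iff:
  assumes x: "x \<in> Obj G" and y: "y \<in> Obj G" and z: "z \<in> Obj G"
  shows "(homotopy_class G x y, homotopy_class G x z) \<in> homotopy_poset G x \<longleftrightarrow> hom G y z \<noteq> {}"
proof (cases "hom G y x = {}"; cases "hom G z x = {}")
  assume "hom G y x = {}" "hom G z x = {}"
  then show ?thesis
    by (simp add: homotopy_le_iff x y z)
next
  assume *: "hom G y x = {}" "hom G z x \<noteq> {}"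
  then have "hom G y z = {}"
    using hom_nonempty_trans[of y z x] by blast
  with * show ?thesis
    by (simp add: homotopy_class_eq_base homotopy_not_le_base x y z)
next
  assume *: "hom G y x \<noteq> {}" "hom G z x = {}"
  then have "hom G y z = {}"
    using hom_nonempty_trans[of z y x] hom_nonempty_sym[of y z] by blast
  \<comment> \<open>Inverting the right leg of a span from \<open>w\<close> to \<open>x\<close> and
    \<open>z\<close> would give a composite from \<open>z\<close> through \<open>w\<close> to
    \<open>x\<close>.\<close>
  moreover have "\<nexists>w. hom G w x \<noteq> {} \<and> hom G w z \<noteq> {}"
    using * hom_nonempty_trans[of z _ x] hom_nonempty_sym[of _ z] by blast
  ultimately show ?thesis
    using * homotopy_base_le_iff[OF x z] by (auto simp: homotopy_class_eq_base x y)
next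
  assume *: "hom G y x \<noteq> {}" "hom G z x \<noteq> {}"
  \<comment> \<open>Both objects collapse, and inverting the arrow from \<open>z\<close> to
    \<open>x\<close> links them through \<open>x\<close>.\<close>
  then have "hom G y z \<noteq> {}"
    using hom_nonempty_trans[of y x z] hom_nonempty_sym[of z x] by blast
  moreover have "(homotopy_base G x, homotopy_base G x) \<in> homotopy_poset G x"
    using Partial_order_homotopy_poset Field_homotopy_poset[OF x]
    by (auto simp: partial_order_on_def preorder_on_def refl_on_def)
  ultimately show ?thesis
    using * by (simp add: homotopy_class_eq_base x y z)
qed

lemma homotopy_class_eq_iff:
  assumes "x \<in> Obj G" "y \<in> Obj G" "z \<in> Obj G"
  shows "homotopy_class G x y = homotopy_class G x z \<longleftrightarrow> hom G y z \<noteq> {}"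
proof
  assume eq: "homotopy_class G x y = homotopy_class G x z"
  \<comment> \<open>The identity of \<open>y\<close> makes its class comparable with itself;
    \<open>eq\<close> turns this into a comparison with the class of \<open>z\<close>.\<close>
  have "hom G y y \<noteq> {}"
    using id_hom assms(2) by auto
  then show "hom G y z \<noteq> {}"
    using homotopy_class_le_iff[OF assms(1,2,2)] homotopy_class_le_iff[OF assms] eq by simp
next
  assume "hom G y z \<noteq> {}"
  then have "(homotopy_class G x y, homotopy_class G x z) \<in> homotopy_poset G x"
    and "(homotopy_class G x z, homotopy_class G x y) \<in> homotopy_poset G x"
    using homotopy_class_le_iff[OF assms] homotopy_class_le_iff[OF assms(1,3,2)]
      hom_nonempty_sym[of y z] by simp_all
  moreover have "antisym (homotopy_poset G x)"
    using Partial_order_homotopy_poset by (simp add: partial_order_on_def)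
  ultimately show "homotopy_class G x y = homotopy_class G x z"
    by (simp add: antisymD)
qed

text \<open>Comparability and equality of classes both amount to the existence of an arrow between
  representatives.\<close>

lemma discrete_homotopy_poset:
  assumes "x \<in> Obj G"
  shows "discrete_poset (homotopy_poset G x)"
  unfolding discrete_poset_def
proof (intro conjI allI impI)
  fix a b assume ab: "(a, b) \<in> homotopy_poset G x"
  then have "a \<in> homotopy_class G x ` Obj G" "b \<in> homotopy_class G x ` Obj G"
    unfolding Field_homotopy_poset_image[OF assms, symmetric] by (rule FieldI1, rule FieldI2)
  then obtain y z where "y \<in> Obj G" "z \<in> Obj G"
    "a = homotopy_class G x y" "b = homotopy_class G x z"
    by (elim imageE)
  with ab show "a = b"
    by (simp add: homotopy_class_le_iff homotopy_class_eq_iff assms)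
qed (rule Partial_order_homotopy_poset)

text \<open>\<open>homotopy_class G x\<close> and \<open>component G\<close> identify the same pairs
  of objects, namely those joined by an arrow, so their images correspond.\<close>

lemma homotopy_poset_iso_components:
  assumes "x \<in> Obj G"
  shows "pointed_set_iso (Field (homotopy_poset G x)) (homotopy_base G x)
    (components G) (component G x)"
proof -
  have components: "components G = component G ` Obj G"
    by (auto simp: components_def component_def quotient_def)
  have "\<exists>\<phi>. bij_betw \<phi> (homotopy_class G x ` Obj G) (component G ` Obj G) \<and>
      (\<forall>y\<in>Obj G. \<phi> (homotopy_class G x y) = component G y)"
    by (rule bij_betw_images) (simp add: homotopy_class_eq_iff component_eq_iff assms)
  then obtain \<phi> where "bij_betw \<phi> (homotopy_class G x ` Obj G) (component G ` Obj G)"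
    and "\<forall>y\<in>Obj G. \<phi> (homotopy_class G x y) = component G y"
    by (elim exE conjE)
  \<comment> \<open>Writing the base point as the class of \<open>x\<close> makes its preservation
    an instance of the formula for \<open>\<phi>\<close>.\<close>
  then show ?thesis
    unfolding pointed_set_iso_def components Field_homotopy_poset_image[OF assms]
      homotopy_class_self[OF assms, symmetric]
    by (intro conjI exI[of _ \<phi>] imageI) (simp_all add: assms)
qed

end

theorem proposition6:
  fixes G :: "('o, 'm) cat" and x :: 'o
  assumes "groupoid G" and "x \<in> Obj G"
  shows "discrete_poset (homotopy_poset G x) \<and>
    pointed_set_iso (Field (homotopy_poset G x)) (homotopy_base G x)
      (components G) (component G x)"
  using groupoid.discrete_homotopy_poset[OF assms]
    groupoid.homotopy_poset_iso_components[OF assms] by (rule conjI)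

end
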